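(* Let $D$ be a symmetric digraph and let $G$ be its underlying undirected graph (same vertex set, with $u,v$ adjacent in $G$ if and only if $(u,v)$ and $(v,u)$ are arcs of $D$). Then $\zeta(D)=\zeta(G)$, where $\zeta$ denotes the localization number.
   Context: Graphs and digraphs are finite, without loops or multiple edges/arcs. A digraph may contain digons (the two arcs $(u,v)$ and $(v,u)$); it is symmetric if for every arc $(u,v)$ there is also an arc $(v,u)$. Localization game on a graph or digraph: one player controls a set of $k$ cops, the other an invisible robber. The robber first chooses an initial vertex. In each subsequent round the cops move (each cop may choose any vertex to occupy), and then the robber moves to a neighbouring vertex (along an edge, or along an arc in its direction, in the directed case) or stays. After each robber move, if the cops occupy $u_1,\dots,u_k$, they receive the distance vector $(d_1,\dots,d_k)$, where $d_i$ is the distance from $u_i$ to the robber's vertex (in a digraph, the length of a shortest directed path from $u_i$ to the robber's vertex; if there is no path the distance is recorded as $\infty$). The robber is located if in some round there is a unique vertex the robber can occupy that corresponds to the distance vector received (the cops may use information from previous rounds). The cops win if they have a strategy that locates the robber in a finite number of rounds. The localization number $\zeta$ is the minimum number of cops with which the cops win, the robber playing optimally. *)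

theory Defs
  imports "Graph_Theory.Graph_Theory" "HOL-Library.Extended_Nat"
begin

section \<open>Undirected graphs\<close>

text \<open>
  \<^theory>\<open>Graph_Theory.Digraph\<close> encodes undirected graphs as symmetric digraphs. Here the two
  notions have to be kept apart, so undirected graphs get a type of their own, with two-element
  sets as edges. Digraphs are the \<^locale>\<open>pair_digraph\<close> of the library: finite, without loops,
  with ordered pairs as arcs.
\<close>

record 'a ugraph =
  uverts :: "'a set"
  uedges :: "'a set set"

locale simple_ugraph =
  fixes G :: "'a ugraph"
  assumes finite_uverts: "finite (uverts G)"
    and uedgesD: "e \<in> uedges G \<Longrightarrow> \<exists>u v. e = {u, v} \<and> u \<noteq> v \<and> u \<in> uverts G \<and> v \<in> uverts G"

definition uadj :: "'a ugraph \<Rightarrow> 'a \<Rightarrow> 'a \<Rightarrow> bool" where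
  "uadj G u v \<longleftrightarrow> {u, v} \<in> uedges G"

definition underlying_ugraph :: "'a pair_pre_digraph \<Rightarrow> 'a ugraph" where
  "underlying_ugraph D =
     \<lparr> uverts = pverts D, uedges = {{u, v} |u v. (u, v) \<in> parcs D \<and> (v, u) \<in> parcs D} \<rparr>"

lemma uverts_underlying: "uverts (underlying_ugraph D) = pverts D"
  by (simp add: underlying_ugraph_def)

lemma uadj_underlying:
  "uadj (underlying_ugraph D) u v \<longleftrightarrow> (u, v) \<in> parcs D \<and> (v, u) \<in> parcs D"
  by (auto simp: uadj_def underlying_ugraph_def doubleton_eq_iff)

lemma simple_ugraph_underlying:
  assumes "pair_digraph D"
  shows "simple_ugraph (underlying_ugraph D)"
proof -
  interpret pair_digraph D by (rule assms)
  show ?thesis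
  proof
    show "finite (uverts (underlying_ugraph D))"
      by (simp add: uverts_underlying pair_finite_verts)
  next
    fix e assume "e \<in> uedges (underlying_ugraph D)"
    then obtain u v where "e = {u, v}" "(u, v) \<in> parcs D"
      by (auto simp: underlying_ugraph_def)
    then show "\<exists>u v. e = {u, v} \<and> u \<noteq> v \<and>
        u \<in> uverts (underlying_ugraph D) \<and> v \<in> uverts (underlying_ugraph D)"
      using pair_no_loops[of "(u, v)"] in_arcsD1[of u v] in_arcsD2[of u v]
      by (auto simp: uverts_underlying)
  qed
qed


section \<open>Distances\<close>

text \<open>
  In both cases the infimum of the empty set is \<open>\<infinity>\<close>, the value recorded when there is no path.
\<close>

definition ddist :: "'a pair_pre_digraph \<Rightarrow> 'a \<Rightarrow> 'a \<Rightarrow> enat" where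
  "ddist D u v = (INF p \<in> {p. pre_digraph.apath (with_proj D) u p v}. enat (length p))"

text \<open>Undirected paths are given by their vertex lists, hence the length \<open>length p - 1\<close>.\<close>

definition upath :: "'a ugraph \<Rightarrow> 'a \<Rightarrow> 'a list \<Rightarrow> 'a \<Rightarrow> bool" where
  "upath G u p v \<longleftrightarrow> p \<noteq> [] \<and> hd p = u \<and> last p = v \<and>
     set p \<subseteq> uverts G \<and> distinct p \<and> successively (uadj G) p"

definition udist :: "'a ugraph \<Rightarrow> 'a \<Rightarrow> 'a \<Rightarrow> enat" where
  "udist G u v = (INF p \<in> {p. upath G u p v}. enat (length p - 1))"


section \<open>The localization game\<close>

text \<open>
  The rules are the same for graphs and digraphs; they depend on the vertex set \<open>V\<close>, on the
  relation \<open>E\<close> along which the robber may move, and on the distance \<open>d\<close>.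

  A play of the robber is the sequence of his positions: \<open>r 0\<close> is his initial vertex and
  \<open>r n\<close> his vertex after his move in round \<open>n \<ge> 1\<close>. A strategy \<open>S\<close> of the cops maps the list
  of distance vectors received in the previous rounds to the list of the cops' next positions
  (their own previous positions are determined by \<open>S\<close> and these vectors).
\<close>

definition robber_play :: "'a set \<Rightarrow> ('a \<Rightarrow> 'a \<Rightarrow> bool) \<Rightarrow> (nat \<Rightarrow> 'a) \<Rightarrow> bool" where
  "robber_play V E r \<longleftrightarrow> r 0 \<in> V \<and> (\<forall>n. r (Suc n) = r n \<or> E (r n) (r (Suc n)))"

definition cop_strategy :: "'a set \<Rightarrow> nat \<Rightarrow> (enat list list \<Rightarrow> 'a list) \<Rightarrow> bool" where
  "cop_strategy V k S \<longleftrightarrow> (\<forall>h. length (S h) = k \<and> set (S h) \<subseteq> V)"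

text \<open>The distance vectors received in rounds \<open>1, \<dots>, n\<close>.\<close>

primrec received ::
  "('a \<Rightarrow> 'a \<Rightarrow> enat) \<Rightarrow> (enat list list \<Rightarrow> 'a list) \<Rightarrow> (nat \<Rightarrow> 'a) \<Rightarrow> nat \<Rightarrow> enat list list"
where
  "received d S r 0 = []"
| "received d S r (Suc n) =
     received d S r n @ [map (\<lambda>u. d u (r (Suc n))) (S (received d S r n))]"

text \<open>The vertices where the robber can be after round \<open>n\<close>, given all the vectors received.\<close>

definition possible_positions ::
  "'a set \<Rightarrow> ('a \<Rightarrow> 'a \<Rightarrow> bool) \<Rightarrow> ('a \<Rightarrow> 'a \<Rightarrow> enat) \<Rightarrow> (enat list list \<Rightarrow> 'a list) \<Rightarrow>
     (nat \<Rightarrow> 'a) \<Rightarrow> nat \<Rightarrow> 'a set"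
where
  "possible_positions V E d S r n =
     {r' n |r'. robber_play V E r' \<and> received d S r' n = received d S r n}"

text \<open>
  Since \<open>S\<close> is deterministic, a robber playing optimally against \<open>S\<close> is captured by
  quantifying over all his plays.
\<close>

definition cops_win ::
  "'a set \<Rightarrow> ('a \<Rightarrow> 'a \<Rightarrow> bool) \<Rightarrow> ('a \<Rightarrow> 'a \<Rightarrow> enat) \<Rightarrow> nat \<Rightarrow> bool"
where
  "cops_win V E d k \<longleftrightarrow> (\<exists>S. cop_strategy V k S \<and>
     (\<forall>r. robber_play V E r \<longrightarrow> (\<exists>n\<ge>1. \<exists>!v. v \<in> possible_positions V E d S r n)))"

definition localization_number ::
  "'a set \<Rightarrow> ('a \<Rightarrow> 'a \<Rightarrow> bool) \<Rightarrow> ('a \<Rightarrow> 'a \<Rightarrow> enat) \<Rightarrow> nat"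
where
  "localization_number V E d = (LEAST k. cops_win V E d k)"

definition zeta_digraph :: "'a pair_pre_digraph \<Rightarrow> nat" where
  "zeta_digraph D = localization_number (pverts D) (\<lambda>u v. (u, v) \<in> parcs D) (ddist D)"

definition zeta_ugraph :: "'a ugraph \<Rightarrow> nat" where
  "zeta_ugraph G = localization_number (uverts G) (uadj G) (udist G)"


section \<open>The minimum is attained\<close>

text \<open>
  One cop on every vertex locates the robber in the first round, so \<open>LEAST\<close> above is never
  taken over an empty set.
\<close>

lemma cops_win_card:
  assumes "finite V" and E: "\<And>u v. E u v \<Longrightarrow> v \<in> V"
    and d: "\<And>u v. u \<in> V \<Longrightarrow> v \<in> V \<Longrightarrow> d u v = 0 \<longleftrightarrow> u = v"
  shows "cops_win V E d (card V)"
proof -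
  obtain xs where xs: "set xs = V" "distinct xs"
    using finite_distinct_list[OF assms(1)] by blast
  define S :: "enat list list \<Rightarrow> 'a list" where "S = (\<lambda>_. xs)"
  have "\<exists>!v. v \<in> possible_positions V E d S r 1" if r: "robber_play V E r" for r
  proof
    show "r 1 \<in> possible_positions V E d S r 1"
      using r by (auto simp: possible_positions_def)
  next
    fix v assume "v \<in> possible_positions V E d S r 1"
    then obtain r' where r': "robber_play V E r'" "received d S r' 1 = received d S r 1"
      and v: "v = r' 1"
      by (auto simp: possible_positions_def)
    have in_V: "q 1 \<in> V" if "robber_play V E q" for q
      using that E unfolding robber_play_def by (metis One_nat_def)
    have "d (r 1) (r' 1) = d (r 1) (r 1)"
      using r'(2) in_V[OF r] xs(1) by (simp add: S_def)
    then show "v = r 1"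
      using d in_V[OF r] in_V[OF r'(1)] v by metis
  qed
  moreover have "cop_strategy V (card V) S"
    using xs by (auto simp: cop_strategy_def S_def distinct_card)
  ultimately show ?thesis
    unfolding cops_win_def by blast
qed

lemma INF_enat_eq_0_iff: "(INF p \<in> A. enat (f p)) = 0 \<longleftrightarrow> (\<exists>p \<in> A. f p = 0)"
proof
  assume "(INF p \<in> A. enat (f p)) = 0"
  then have "(INF p \<in> A. enat (f p)) < 1" by simp
  then obtain p where "p \<in> A" "enat (f p) < 1"
    by (auto simp: INF_less_iff)
  then show "\<exists>p \<in> A. f p = 0"
    by (auto simp: one_enat_def)
next
  assume "\<exists>p \<in> A. f p = 0"
  then obtain p where "p \<in> A" "f p = 0" by blast
  then have "(INF p \<in> A. enat (f p)) \<le> 0"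
    by (intro INF_lower2[of p]) (auto simp: zero_enat_def)
  then show "(INF p \<in> A. enat (f p)) = 0" by simp
qed

lemma cops_win_digraph:
  assumes "pair_digraph D"
  shows "cops_win (pverts D) (\<lambda>u v. (u, v) \<in> parcs D) (ddist D) (card (pverts D))"
proof -
  interpret pair_digraph D by (rule assms)
  show ?thesis
  proof (rule cops_win_card)
    fix u v assume "u \<in> pverts D" "v \<in> pverts D"
    then show "ddist D u v = 0 \<longleftrightarrow> u = v"
      by (auto simp: ddist_def INF_enat_eq_0_iff apath_def awalk_def)
  qed (auto simp: pair_finite_verts dest: in_arcsD2)
qed

lemma cops_win_ugraph:
  assumes "simple_ugraph G"
  shows "cops_win (uverts G) (uadj G) (udist G) (card (uverts G))"
proof -
  interpret simple_ugraph G by (rule assms)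
  show ?thesis
  proof (rule cops_win_card)
    fix u v assume "uadj G u v"
    then show "v \<in> uverts G"
      using uedgesD[of "{u, v}"] by (auto simp: uadj_def doubleton_eq_iff)
  next
    fix u v assume uv: "u \<in> uverts G" "v \<in> uverts G"
    have "hd p = last p" if "p \<noteq> []" "length p - 1 = 0" for p :: "'a list"
      using that by (cases p) auto
    moreover have "upath G u [u] u" using uv by (simp add: upath_def)
    ultimately show "udist G u v = 0 \<longleftrightarrow> u = v"
      by (auto simp: udist_def INF_enat_eq_0_iff upath_def intro!: exI[of _ "[u]"])
  qed (rule finite_uverts)
qed

end

theory Submission
  imports Defs
begin

text \<open>
  The two localization numbers are values of one functional of the vertex set, the robber's moves
  and the distance, so it suffices that all three data agree for \<open>D\<close> and \<open>G\<close>. The vertex sets are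
  equal by definition. In a symmetric digraph every arc has its reverse, so an arc is the same
  thing as an adjacency of the underlying graph, and the robber has the same moves. The distances
  agree because directed paths from \<open>u\<close> to \<open>v\<close> correspond to undirected ones of the same length:
  a directed path, given by its arcs, is turned into the list of its vertices
  (\<open>apath_imp_upath\<close>), and a vertex list into its consecutive pairs (\<open>upath_imp_apath\<close>). Outside
  the vertex set there is no path of either kind, so the distance functions are equal everywhere,
  and the games are literally the same.
\<close>

lemma uadj_underlying_symmetric:
  assumes "symmetric (with_proj D)"
  shows "uadj (underlying_ugraph D) = (\<lambda>u v. (u, v) \<in> parcs D)"
  using assms by (auto simp: fun_eq_iff uadj_underlying symmetric_def elim: symE)

context pair_digraph
begin

text \<open>
  By symmetry every arc of the path is an edge, and both notions of path forbid repeated vertices,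
  so the vertex list inherits distinctness.
\<close>

lemma apath_imp_upath:
  assumes "symmetric G" "apath u p v"
  shows "upath (underlying_ugraph G) u (awalk_verts u p) v"
  using assms(2)
proof (induction p arbitrary: u)
  case Nil
  then show ?case
    by (auto simp: apath_Nil_iff upath_def uverts_underlying)
next
  case (Cons a p)
  obtain w where a: "a = (u, w)" "(u, w) \<in> parcs G" and p: "apath w p v"
    and "u \<notin> set (awalk_verts w p)"
    using Cons.prems by (cases a) (auto simp: apath_Cons_iff)
  then show ?case
    using Cons.IH[OF p] uadj_underlying_symmetric[OF assms(1)] in_arcsD1[OF a(2)]
    by (auto simp: upath_def uverts_underlying successively_Cons)
qed

lemma awalk_verts_vwalk_arcs: "awalk_verts u (vwalk_arcs (u # xs)) = u # xs"
  by (induction xs arbitrary: u) auto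

text \<open>
  An edge of the underlying graph stems from arcs in both directions, so each step of an undirected
  path can be taken in the direction of travel.
\<close>

lemma upath_imp_apath:
  assumes "upath (underlying_ugraph G) u xs v"
  shows "apath u (vwalk_arcs xs) v"
  using assms
proof (induction xs arbitrary: u rule: vwalk_arcs.induct)
  case (3 x y xs)
  have u: "u = x" "(x, y) \<in> parcs G" "x \<notin> set (y # xs)"
    and tail: "upath (underlying_ugraph G) y (y # xs) v"
    using "3.prems" by (auto simp: upath_def uadj_underlying)
  show ?case
    using "3.IH"[OF tail] u by (simp add: apath_Cons_iff awalk_verts_vwalk_arcs)
qed (auto simp: upath_def apath_Nil_iff uverts_underlying)

lemma udist_underlying:
  assumes "symmetric G"
  shows "udist (underlying_ugraph G) = ddist G"
proof (intro ext)
  fix u v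
  have "length ` {p. apath u p v} =
      (\<lambda>xs. length xs - 1) ` {xs. upath (underlying_ugraph G) u xs v}"
    (is "?A = ?U")
  proof
    show "?A \<subseteq> ?U"
      using apath_imp_upath[OF assms] by (force simp: length_awalk_verts)
    show "?U \<subseteq> ?A"
    proof
      fix n assume "n \<in> ?U"
      then obtain xs where "apath u (vwalk_arcs xs) v" "n = vwalk_length xs"
        using upath_imp_apath by auto
      then show "n \<in> ?A"
        by (auto simp del: vwalk_length_simp simp: vwalk_length_def)
    qed
  qed
  then have "enat ` ?A = enat ` ?U"
    by simp
  then show "udist (underlying_ugraph G) u v = ddist G u v"
    by (simp add: udist_def ddist_def image_image)
qed

end

theorem theorem1p1:
  fixes D :: "'a pair_pre_digraph"
  assumes "pair_digraph D" and "symmetric (with_proj D)"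
  shows "zeta_digraph D = zeta_ugraph (underlying_ugraph D)"
  by (simp add: zeta_digraph_def zeta_ugraph_def uverts_underlying
      uadj_underlying_symmetric[OF assms(2)] pair_digraph.udist_underlying[OF assms])

end
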